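(* For any $w\in C\cap\overline{B}_\beta$, the Mordukhovich normal cone is $$N(w,C\cap\overline{B}_\beta)=\Big\{y\in\mathbb{R}^d:\exists X\in Y,\ \forall i\in X,\ \forall j\in[d_i],\ y^i_j\in\begin{cases}\mathbb{R}_{\ge0}&\text{if }w^i_j=\beta\\ \{0\}&\text{if }|w^i_j|<\beta\\ \mathbb{R}_{\le0}&\text{if }w^i_j=-\beta\end{cases}\Big\},$$ where $Y:=\{X\subseteq[n]:I(w)\subseteq X,\ \sum_{i\in X}p_i\le m,\text{ and }\sum_{i\in X}p_i+p_j>m\ \ \forall j\in[n]\setminus X\}$.
   Context: $[n]:=\{1,\dots,n\}$. For $n\le d$, the coordinates of a vector in $\mathbb{R}^d$ are partitioned into blocks $w^1,\dots,w^n$, with $w^i\in\mathbb{R}^{d_i}$ and $\sum_{i=1}^nd_i=d$. Let $m>0$ and $0<p_i\le m$ for $i\in[n]$. Let $C:=\{w\in\mathbb{R}^d:\sum_{i=1}^np_i\mathbb{1}_{\{w^i\ne0\}}(w)\le m\}$, where $\{w^i\neq0\}$ is the set of $w$ whose $i$-th block is not the zero vector. $\beta>0$ and $\overline{B}_\beta:=\{z\in\mathbb{R}^d:|z_i|\le\beta,\ i=1,\dots,d\}$. For $w\in C\cap\overline{B}_\beta$, $I(w):=\{i\in[n]:w^i\ne0\}$. For a set $A$ and $w\in A$, $\widehat N(w,A):=\{y\in\mathbb{R}^d:\limsup_{x\to w,\,x\in A}\frac{\langle y,x-w\rangle}{\|x-w\|_2}\le0\}$ (Fréchet normal cone), and the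 Mordukhovich normal cone $N(w,A)$ is the set of all limits $y$ of sequences $y_k\in\widehat N(x_k,A)$ with $x_k\in A$, $x_k\to w$. *)

theory Defs
  imports "HOL-Analysis.Analysis"
begin

(* The limsup is taken in the extended reals; at an isolated point of A it is -\<infinity>,
   so the cone is then the whole space. *)
definition frechet_normal_cone :: "'a::euclidean_space \<Rightarrow> 'a set \<Rightarrow> 'a set" where
  "frechet_normal_cone w A =
     {y. Limsup (at w within A) (\<lambda>x. ereal (y \<bullet> (x - w) / norm (x - w))) \<le> 0}"

definition mordukhovich_normal_cone :: "'a::euclidean_space \<Rightarrow> 'a set \<Rightarrow> 'a set" where
  "mordukhovich_normal_cone w A =
     {y. \<exists>x u. (\<forall>k. x k \<in> A \<and> u k \<in> frechet_normal_cone (x k) A)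
              \<and> x \<longlonglongrightarrow> w \<and> u \<longlonglongrightarrow> y}"

(* The partition of the coordinates 'd into blocks indexed by 'n is given by the map
   b :: 'd \<Rightarrow> 'n assigning to each coordinate its block; b is surjective exactly if no block is
   empty.  A block of w is represented by a vector of the full space, padded with zeros outside
   of the block. *)
definition block :: "('d::finite \<Rightarrow> 'n) \<Rightarrow> real ^ 'd \<Rightarrow> 'n \<Rightarrow> real ^ 'd" where
  "block b w i = (\<chi> j. if b j = i then w $ j else 0)"

definition active_blocks :: "('d::finite \<Rightarrow> 'n) \<Rightarrow> real ^ 'd \<Rightarrow> 'n set" where
  "active_blocks b w = {i. block b w i \<noteq> 0}"

definition knapsack_set :: "('d::finite \<Rightarrow> 'n::finite) \<Rightarrow> ('n \<Rightarrow> real) \<Rightarrow> real \<Rightarrow> (real ^ 'd) set" where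
  "knapsack_set b p m = {w. (\<Sum>i\<in>UNIV. p i * indicator {v. block b v i \<noteq> 0} w) \<le> m}"

definition sup_ball :: "real \<Rightarrow> (real ^ 'd::finite) set" where
  "sup_ball \<beta> = {z. \<forall>j. \<bar>z $ j\<bar> \<le> \<beta>}"

definition maximal_supports ::
  "('d::finite \<Rightarrow> 'n::finite) \<Rightarrow> ('n \<Rightarrow> real) \<Rightarrow> real \<Rightarrow> real ^ 'd \<Rightarrow> 'n set set" where
  "maximal_supports b p m w =
     {X. active_blocks b w \<subseteq> X \<and> sum p X \<le> m \<and> (\<forall>j\<in>UNIV - X. sum p X + p j > m)}"

end

theory Submission
  imports Defs
begin

text \<open>
  At a point whose support is already a maximal set \<open>X\<close>, the set coincides locally with a box in the
  coordinates of \<open>X\<close>, so there the Frechet normals contain every vector that satisfies the sign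
  conditions on \<open>X\<close>. Conversely, a support always extends to a maximal \<open>X\<close>, within
  which single coordinates can be moved freely inside the box; this forces the sign conditions.
  Passing to limits, only finitely many \<open>X\<close> occur, so one of them occurs infinitely often.
\<close>

section \<open>Frechet normals of a general set\<close>

text \<open>Along the ray from \<open>x\<close> in direction \<open>v\<close> the quotient in the
  limsup has the constant value \<open>u \<bullet> v / norm v\<close>, because the positive factor
  \<open>t\<close> cancels.\<close>

lemma frechet_normal_cone_feasible_direction:
  fixes x :: "'a::euclidean_space"
  assumes u: "u \<in> frechet_normal_cone x A"
    and feasible: "eventually (\<lambda>t. x + t *\<^sub>R v \<in> A) (at_right 0)"
  shows "u \<bullet> v \<le> 0"
proof (cases "v = 0")
  case False
  have lim: "filterlim (\<lambda>t. x + t *\<^sub>R v) (at x within A) (at_right 0)"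
  proof (subst filterlim_at, intro conjI)
    show "\<forall>\<^sub>F t in at_right 0. x + t *\<^sub>R v \<in> A \<and> x + t *\<^sub>R v \<noteq> x"
      using feasible eventually_at_right_less[of "0::real"]
      by eventually_elim (use False in auto)
    have "((\<lambda>t. x + t *\<^sub>R v) \<longlongrightarrow> x + 0 *\<^sub>R v) (at_right 0)"
      by (intro tendsto_intros)
    then show "((\<lambda>t. x + t *\<^sub>R v) \<longlongrightarrow> x) (at_right 0)" by simp
  qed
  have "u \<bullet> v / norm v \<le> 0"
  \<comment> \<open>A limsup yields an eventual bound only for constants strictly above it, hence
    the slack \<open>e\<close>.\<close>
  proof (rule field_le_epsilon)
    fix e :: real
    assume "e > 0"
    have "Limsup (at x within A) (\<lambda>z. ereal (u \<bullet> (z - x) / norm (z - x))) < ereal e"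
      using u \<open>e > 0\<close> by (auto simp: frechet_normal_cone_def intro: le_less_trans)
    then have "eventually (\<lambda>z. ereal (u \<bullet> (z - x) / norm (z - x)) < ereal e) (at x within A)"
      by (rule Limsup_lessD)
    then have "eventually (\<lambda>t. u \<bullet> (t *\<^sub>R v) / norm (t *\<^sub>R v) < e) (at_right 0)"
      using lim by (auto simp: filterlim_iff)
    then have "eventually (\<lambda>t::real. u \<bullet> v / norm v < e) (at_right 0)"
      using eventually_at_right_less[of "0::real"]
      by eventually_elim (use False in \<open>auto simp: divide_simps\<close>)
    then show "u \<bullet> v / norm v \<le> 0 + e"
      using eventually_happens'[of "at_right (0::real)"] by fastforce
  qed
  then show ?thesis using False by (simp add: divide_le_0_iff)
qed simp

lemma frechet_normal_coneI:
  fixes x :: "'a::euclidean_space"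
  assumes "eventually (\<lambda>z. z \<in> A \<longrightarrow> u \<bullet> (z - x) \<le> 0) (nhds x)"
  shows "u \<in> frechet_normal_cone x A"
proof -
  have "eventually (\<lambda>z. ereal (u \<bullet> (z - x) / norm (z - x)) \<le> 0) (at x within A)"
    using assms by (auto simp: eventually_at_filter divide_le_0_iff elim: eventually_mono)
  then show ?thesis
    unfolding frechet_normal_cone_def by (simp add: Limsup_bounded)
qed

section \<open>Supports and their maximal extensions\<close>

lemma mem_active_blocks: "i \<in> active_blocks b w \<longleftrightarrow> (\<exists>j. b j = i \<and> w $ j \<noteq> 0)"
  by (auto simp: active_blocks_def block_def vec_eq_iff)

lemma mem_knapsack_set: "w \<in> knapsack_set b p m \<longleftrightarrow> sum p (active_blocks b w) \<le> m"
proof -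
  have "(\<Sum>i\<in>UNIV. p i * indicator {v. block b v i \<noteq> 0} w) =
      (\<Sum>i\<in>UNIV. if i \<in> active_blocks b w then p i else 0)"
    by (intro sum.cong) (auto simp: active_blocks_def)
  then show ?thesis
    by (simp add: knapsack_set_def sum.If_cases)
qed

text \<open>A nonzero coordinate stays nonzero nearby, and there are only finitely many
  coordinates.\<close>

lemma eventually_active_blocks_mono:
  fixes w :: "real ^ 'd::finite"
  shows "eventually (\<lambda>z. active_blocks b w \<subseteq> active_blocks b z) (nhds w)"
proof -
  have "eventually (\<lambda>z. w $ j \<noteq> 0 \<longrightarrow> z $ j \<noteq> 0) (nhds w)" for j
  proof (cases "w $ j = 0")
    case False
    have "((\<lambda>z. z $ j) \<longlongrightarrow> w $ j) (nhds w)"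
      by (intro tendsto_vec_nth filterlim_ident)
    from tendsto_imp_eventually_ne[OF this False] show ?thesis
      by eventually_elim simp
  qed simp
  then have "eventually (\<lambda>z. \<forall>j. w $ j \<noteq> 0 \<longrightarrow> z $ j \<noteq> 0) (nhds w)"
    by (rule eventually_all_finite)
  then show ?thesis
    by eventually_elim (unfold subset_iff mem_active_blocks, blast)
qed

text \<open>Take an inclusion-maximal set among the finitely many supersets of the support with
  weight at most \<open>m\<close>; an index that still fitted would enlarge it.\<close>

lemma maximal_supports_nonempty:
  fixes p :: "'n::finite \<Rightarrow> real"
  assumes "w \<in> knapsack_set b p m"
  obtains X where "X \<in> maximal_supports b p m w"
proof -
  let ?F = "{X. active_blocks b w \<subseteq> X \<and> sum p X \<le> m}"
  have "?F \<noteq> {}"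
    using assms by (auto simp: mem_knapsack_set)
  then obtain X where X: "X \<in> ?F" and max: "\<And>Z. Z \<in> ?F \<Longrightarrow> X \<subseteq> Z \<Longrightarrow> Z = X"
    using finite_has_maximal[of ?F] by (metis (lifting) finite)
  have "sum p X + p j > m" if "j \<notin> X" for j
  proof (rule ccontr)
    assume "\<not> sum p X + p j > m"
    with X that have "insert j X \<in> ?F" by auto
    with max[OF this] that show False by auto
  qed
  with X have "X \<in> maximal_supports b p m w"
    by (simp add: maximal_supports_def)
  then show thesis by (rule that)
qed

section \<open>Frechet normals of the knapsack set within the box\<close>

text \<open>Changing coordinate \<open>j\<close> keeps the support inside \<open>X\<close>, whose
  weight is affordable, so only the box restricts the move: upwards is feasible below
  \<open>\<beta>\<close>, downwards above \<open>- \<beta>\<close>.\<close>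

lemma frechet_normal_cone_knapsack_sign:
  fixes b :: "'d::finite \<Rightarrow> 'n::finite" and x :: "real ^ 'd"
  assumes p: "\<And>i. 0 < p i"
    and x: "x \<in> knapsack_set b p m \<inter> sup_ball \<beta>"
    and u: "u \<in> frechet_normal_cone x (knapsack_set b p m \<inter> sup_ball \<beta>)"
    and X: "active_blocks b x \<subseteq> X" "sum p X \<le> m" "b j \<in> X"
  shows "x $ j < \<beta> \<Longrightarrow> u $ j \<le> 0" and "- \<beta> < x $ j \<Longrightarrow> 0 \<le> u $ j"
proof -
  have sign: "u $ j * c \<le> 0"
    if "eventually (\<lambda>t. \<bar>x $ j + t * c\<bar> \<le> \<beta>) (at_right 0)" for c
  proof -
    have "eventually (\<lambda>t. x + t *\<^sub>R axis j c \<in> knapsack_set b p m \<inter> sup_ball \<beta>) (at_right 0)"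
      using that
    proof eventually_elim
      case (elim t)
      have "active_blocks b (x + t *\<^sub>R axis j c) \<subseteq> X"
        using X(1,3) by (force simp: mem_active_blocks axis_def split: if_splits)
      then have "sum p (active_blocks b (x + t *\<^sub>R axis j c)) \<le> sum p X"
        by (intro sum_mono2) (auto intro: less_imp_le p)
      moreover have "x + t *\<^sub>R axis j c \<in> sup_ball \<beta>"
        using x elim by (auto simp: sup_ball_def axis_def)
      ultimately show ?case
        using X(2) by (simp add: mem_knapsack_set)
    qed
    then have "u \<bullet> axis j c \<le> 0"
      by (rule frechet_normal_cone_feasible_direction[OF u])
    then show ?thesis
      by (simp add: inner_axis)
  qed
  have box: "\<bar>x $ j\<bar> \<le> \<beta>"
    using x by (simp add: sup_ball_def)
  show "u $ j \<le> 0" if "x $ j < \<beta>"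
  proof -
    have "eventually (\<lambda>t. t < \<beta> - x $ j) (at_right 0)"
      by (rule order_tendstoD(2)[OF tendsto_ident_at]) (use that in simp)
    then have "eventually (\<lambda>t. \<bar>x $ j + t * 1\<bar> \<le> \<beta>) (at_right 0)"
      using eventually_at_right_less[of "0::real"] by eventually_elim (use box in linarith)
    from sign[OF this] show ?thesis by simp
  qed
  show "0 \<le> u $ j" if "- \<beta> < x $ j"
  proof -
    have "eventually (\<lambda>t. t < \<beta> + x $ j) (at_right 0)"
      by (rule order_tendstoD(2)[OF tendsto_ident_at]) (use that in simp)
    then have "eventually (\<lambda>t. \<bar>x $ j + t * (-1)\<bar> \<le> \<beta>) (at_right 0)"
      using eventually_at_right_less[of "0::real"] by eventually_elim (use box in linarith)
    from sign[OF this] show ?thesis by simp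
  qed
qed

text \<open>Points near \<open>x\<close> cannot lose an index of \<open>X\<close>, and the weight
  bound forbids gaining one. All nearby feasible points thus vanish outside \<open>X\<close>, and
  the inner product is nonpositive summand by summand.\<close>

lemma frechet_normal_cone_at_maximal_support:
  fixes b :: "'d::finite \<Rightarrow> 'n::finite" and x :: "real ^ 'd"
  assumes p: "\<And>i. 0 < p i"
    and X: "active_blocks b x = X" "\<And>i. i \<notin> X \<Longrightarrow> sum p X + p i > m"
    and box: "x \<in> sup_ball \<beta>"
    and y: "\<And>j. b j \<in> X \<Longrightarrow> x $ j < \<beta> \<Longrightarrow> y $ j \<le> 0"
      "\<And>j. b j \<in> X \<Longrightarrow> - \<beta> < x $ j \<Longrightarrow> 0 \<le> y $ j"
  shows "y \<in> frechet_normal_cone x (knapsack_set b p m \<inter> sup_ball \<beta>)"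
proof (rule frechet_normal_coneI, rule eventually_mono[OF eventually_active_blocks_mono[of b x]],
    rule impI)
  fix z
  assume sub: "active_blocks b x \<subseteq> active_blocks b z"
    and z: "z \<in> knapsack_set b p m \<inter> sup_ball \<beta>"
  have support: "i \<in> X" if "i \<in> active_blocks b z" for i
  proof (rule ccontr)
    assume "i \<notin> X"
    then have "m < sum p (insert i X)" using X(2) by (simp add: add.commute)
    also have "\<dots> \<le> sum p (active_blocks b z)"
      by (rule sum_mono2) (use sub X(1) that in \<open>auto intro: less_imp_le p\<close>)
    finally show False using z by (simp add: mem_knapsack_set)
  qed
  have "y $ j * (z $ j - x $ j) \<le> 0" for j
  proof (cases "b j \<in> X")
    case False
    then have "z $ j = 0" "x $ j = 0"
      using support X(1) by (auto simp: mem_active_blocks)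
    then show ?thesis by simp
  next
    case True
    have "\<bar>z $ j\<bar> \<le> \<beta>" "\<bar>x $ j\<bar> \<le> \<beta>"
      using z box by (auto simp: sup_ball_def)
    then show ?thesis
      \<comment> \<open>If \<open>z $ j < x $ j\<close>, then \<open>x $ j\<close> exceeds
        \<open>- \<beta>\<close> and so \<open>y $ j\<close> is nonnegative; the opposite order is
        symmetric.\<close>
      using y[OF True] by (cases "z $ j" "x $ j" rule: linorder_cases)
        (auto simp: mult_le_0_iff)
  qed
  then show "y \<bullet> (z - x) \<le> 0"
    by (auto simp: inner_vec_def intro: sum_nonpos)
qed

section \<open>Limits of Frechet normals\<close>

text \<open>The sign conditions are stated with the open premises \<open>w $ j < \<beta>\<close> and
  \<open>- \<beta> < w $ j\<close>, since these carry over to points near \<open>w\<close>, unlike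
  equality with a bound.\<close>

lemma mordukhovich_normal_cone_knapsack:
  fixes b :: "'d::finite \<Rightarrow> 'n::finite" and w :: "real ^ 'd"
  assumes surj: "surj b" and p: "\<And>i. 0 < p i" and \<beta>: "\<beta> > 0"
    and w: "w \<in> knapsack_set b p m \<inter> sup_ball \<beta>"
  shows "y \<in> mordukhovich_normal_cone w (knapsack_set b p m \<inter> sup_ball \<beta>) \<longleftrightarrow>
    (\<exists>X\<in>maximal_supports b p m w. \<forall>j. b j \<in> X \<longrightarrow>
      (w $ j < \<beta> \<longrightarrow> y $ j \<le> 0) \<and> (- \<beta> < w $ j \<longrightarrow> 0 \<le> y $ j))"
    (is "y \<in> mordukhovich_normal_cone w ?A \<longleftrightarrow> ?R")
proof
  assume "y \<in> mordukhovich_normal_cone w ?A"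
  then obtain x u where x: "\<And>k. x k \<in> ?A" and u: "\<And>k. u k \<in> frechet_normal_cone (x k) ?A"
    and xw: "x \<longlonglongrightarrow> w" and uy: "u \<longlonglongrightarrow> y"
    by (auto simp: mordukhovich_normal_cone_def)
  have "\<exists>X. X \<in> maximal_supports b p m (x k)" for k
    using x[of k] by (blast elim: maximal_supports_nonempty)
  then obtain Z where Z: "\<And>k. Z k \<in> maximal_supports b p m (x k)"
    by metis
  have "\<exists>X. frequently (\<lambda>k. Z k = X) sequentially"
  proof (rule ccontr)
    assume "\<nexists>X. frequently (\<lambda>k. Z k = X) sequentially"
    then have "eventually (\<lambda>k. \<forall>X. Z k \<noteq> X) sequentially"
      by (intro eventually_all_finite) (auto simp: frequently_def)
    then show False by simp
  qed
  then obtain X where freq: "frequently (\<lambda>k. Z k = X) sequentially" ..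
  \<comment> \<open>Each use below needs just one index at which \<open>Z k = X\<close> meets an
    eventual property.\<close>
  have common: "\<exists>k. Z k = X \<and> P k" if "eventually P sequentially" for P
    using frequently_eventually_frequently[OF freq that] by (rule frequently_ex)
  have "X \<in> maximal_supports b p m w"
  proof -
    \<comment> \<open>Only the inclusion of the support depends on the point; the two weight
      conditions on \<open>X\<close> are inherited from any \<open>k\<close> with
      \<open>Z k = X\<close>.\<close>
    have "eventually (\<lambda>k. active_blocks b w \<subseteq> active_blocks b (x k)) sequentially"
      using eventually_compose_filterlim[OF eventually_active_blocks_mono xw] .
    from common[OF this] obtain k where "Z k = X" "active_blocks b w \<subseteq> active_blocks b (x k)"
      by blast
    then show ?thesis using Z[of k] by (auto simp: maximal_supports_def)
  qed
  moreover have "(w $ j < \<beta> \<longrightarrow> y $ j \<le> 0) \<and> (- \<beta> < w $ j \<longrightarrow> 0 \<le> y $ j)" if j: "b j \<in> X" for j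
  proof -
    have xj: "(\<lambda>k. x k $ j) \<longlonglongrightarrow> w $ j" and uj: "(\<lambda>k. u k $ j) \<longlonglongrightarrow> y $ j"
      using xw uy by (auto intro: tendsto_vec_nth)
    have sign: "(x k $ j < \<beta> \<longrightarrow> u k $ j \<le> 0) \<and> (- \<beta> < x k $ j \<longrightarrow> 0 \<le> u k $ j)" if "Z k = X" for k
      using frechet_normal_cone_knapsack_sign[OF p x u, of k X j] Z[of k] that j
      by (auto simp: maximal_supports_def)
    have "y $ j \<le> 0" if "w $ j < \<beta>"
    proof (rule ccontr)
      assume "\<not> y $ j \<le> 0"
      then have "eventually (\<lambda>k. x k $ j < \<beta> \<and> 0 < u k $ j) sequentially"
        using order_tendstoD(2)[OF xj that] order_tendstoD(1)[OF uj, of 0]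
        by (auto intro: eventually_conj)
      from common[OF this] sign show False by force
    qed
    moreover have "0 \<le> y $ j" if "- \<beta> < w $ j"
    proof (rule ccontr)
      assume "\<not> 0 \<le> y $ j"
      then have "eventually (\<lambda>k. - \<beta> < x k $ j \<and> u k $ j < 0) sequentially"
        using order_tendstoD(1)[OF xj that] order_tendstoD(2)[OF uj, of 0]
        by (auto intro: eventually_conj)
      from common[OF this] sign show False by force
    qed
    ultimately show ?thesis by blast
  qed
  ultimately show ?R by blast
next
  assume ?R
  then obtain X where X: "active_blocks b w \<subseteq> X" "sum p X \<le> m"
      "\<And>i. i \<notin> X \<Longrightarrow> sum p X + p i > m"
    and y: "\<And>j. b j \<in> X \<Longrightarrow> w $ j < \<beta> \<Longrightarrow> y $ j \<le> 0"
      "\<And>j. b j \<in> X \<Longrightarrow> - \<beta> < w $ j \<Longrightarrow> 0 \<le> y $ j"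
    by (auto simp: maximal_supports_def)
  \<comment> \<open>The perturbation activates exactly the blocks of \<open>X\<close> that vanish in
    \<open>w\<close>; the factor \<open>\<beta> / 2\<close> keeps \<open>e k\<close> strictly
    between 0 and \<open>\<beta>\<close>.\<close>
  define e where "e = (\<lambda>k. \<beta> / 2 * inverse (real (Suc k)))"
  define x :: "nat \<Rightarrow> real ^ 'd" where
    "x = (\<lambda>k. \<chi> j. if b j \<in> X - active_blocks b w then e k else w $ j)"
  have e: "0 < e k" "e k < \<beta>" for k
    using \<beta> by (auto simp: e_def divide_simps)
  have zero: "w $ j = 0" if "b j \<notin> active_blocks b w" for j
    using that by (auto simp: mem_active_blocks)
  have box: "x k \<in> sup_ball \<beta>" for k
    using w e[of k] by (auto simp: x_def sup_ball_def)
  have support: "active_blocks b (x k) = X" for k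
  proof
    have "b j \<in> X" if "x k $ j \<noteq> 0" for j
      using X(1) zero[of j] that by (auto simp: x_def split: if_splits)
    then show "active_blocks b (x k) \<subseteq> X"
      by (auto simp: mem_active_blocks)
    show "X \<subseteq> active_blocks b (x k)"
    proof
      fix i
      assume i: "i \<in> X"
      show "i \<in> active_blocks b (x k)"
      proof (cases "i \<in> active_blocks b w")
        case True
        then obtain j where "b j = i" "w $ j \<noteq> 0" by (auto simp: mem_active_blocks)
        with True show ?thesis
          unfolding mem_active_blocks[of i b "x k"] by (intro exI[of _ j]) (simp add: x_def)
      next
        case False
        \<comment> \<open>Surjectivity enters here: an empty block could not be made active.\<close>
        obtain j where "b j = i" using surj by (metis surjD)
        with False i e[of k] show ?thesis
          unfolding mem_active_blocks[of i b "x k"] by (intro exI[of _ j]) (simp add: x_def)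
      qed
    qed
  qed
  have "x k \<in> ?A" for k
    using box X(2) by (simp add: mem_knapsack_set support)
  \<comment> \<open>The sequence of normals is constant. Perturbed coordinates are 0 in
    \<open>w\<close>, strictly inside the box, so both sign conditions on \<open>y\<close> hold
    there; elsewhere \<open>x k\<close> agrees with \<open>w\<close>.\<close>
  moreover have "y \<in> frechet_normal_cone (x k) ?A" for k
  proof (rule frechet_normal_cone_at_maximal_support[OF p support X(3) box])
    fix j
    assume j: "b j \<in> X"
    show "y $ j \<le> 0" if "x k $ j < \<beta>"
      using y(1)[OF j] that zero[of j] \<beta> by (auto simp: x_def split: if_splits)
    show "0 \<le> y $ j" if "- \<beta> < x k $ j"
      using y(2)[OF j] that zero[of j] \<beta> by (auto simp: x_def split: if_splits)
  qed
  moreover have "x \<longlonglongrightarrow> w"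
  proof (rule vec_tendstoI)
    fix j
    have "e \<longlonglongrightarrow> 0"
      unfolding e_def by (intro tendsto_mult_right_zero LIMSEQ_inverse_real_of_nat)
    then show "(\<lambda>k. x k $ j) \<longlonglongrightarrow> w $ j"
      using zero[of j] by (cases "b j \<in> X - active_blocks b w") (auto simp: x_def)
  qed
  ultimately show "y \<in> mordukhovich_normal_cone w ?A"
    unfolding mordukhovich_normal_cone_def mem_Collect_eq
    by (intro exI[of _ x] exI[of _ "\<lambda>_. y"]) simp
qed

theorem proposition10:
  fixes b :: "'d::finite \<Rightarrow> 'n::finite" and p :: "'n \<Rightarrow> real" and m \<beta> :: real
    and w :: "real ^ 'd"
  assumes "surj b"
    and "m > 0"
    and "\<And>i. 0 < p i" and "\<And>i. p i \<le> m"
    and "\<beta> > 0"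
    and "w \<in> knapsack_set b p m \<inter> sup_ball \<beta>"
  shows "mordukhovich_normal_cone w (knapsack_set b p m \<inter> sup_ball \<beta>) =
    {y. \<exists>X\<in>maximal_supports b p m w. \<forall>i\<in>X. \<forall>j. b j = i \<longrightarrow>
          (w $ j = \<beta> \<longrightarrow> y $ j \<in> {0..}) \<and>
          (\<bar>w $ j\<bar> < \<beta> \<longrightarrow> y $ j \<in> {0}) \<and>
          (w $ j = - \<beta> \<longrightarrow> y $ j \<in> {..0})}"
proof -
  \<comment> \<open>Since \<open>\<beta> > 0\<close>, the two bounds differ, so at either one
    exactly one of the implications has a true premise; strictly between them both apply and force
    0.\<close>
  have sign: "(w $ j < \<beta> \<longrightarrow> y $ j \<le> 0) \<and> (- \<beta> < w $ j \<longrightarrow> 0 \<le> y $ j) \<longleftrightarrow>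
      (w $ j = \<beta> \<longrightarrow> y $ j \<in> {0..}) \<and> (\<bar>w $ j\<bar> < \<beta> \<longrightarrow> y $ j \<in> {0}) \<and>
      (w $ j = - \<beta> \<longrightarrow> y $ j \<in> {..0})" for y :: "real ^ 'd" and j
  proof -
    have "\<bar>w $ j\<bar> \<le> \<beta>" using assms(6) by (simp add: sup_ball_def)
    then consider "w $ j = \<beta>" | "w $ j = - \<beta>" | "\<bar>w $ j\<bar> < \<beta>" by linarith
    then show ?thesis using \<open>\<beta> > 0\<close> by cases auto
  qed
  have by_block: "(\<forall>i\<in>X. \<forall>j. b j = i \<longrightarrow> Q j) \<longleftrightarrow> (\<forall>j. b j \<in> X \<longrightarrow> Q j)" for X Q
    by blast
  show ?thesis
    by (rule set_eqI)
      (simp only: mordukhovich_normal_cone_knapsack[OF assms(1,3,5,6)] mem_Collect_eq by_block sign)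
qed

end
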